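(* Let $d\ge 1$ be an integer. There is no online algorithm with advice for online unit clustering in $\mathbb{Z}^d$ which serves optimally all request sequences of length at least $n$ while reading fewer than $\frac{d}{1+3d}\cdot n$ bits of advice on each of them; that is, any online algorithm with advice that serves every request sequence optimally must, for arbitrarily large $n$, read at least $\frac{d}{1+3d}\cdot n$ bits of advice on some request sequence of $n$ points.
   Context: Online unit clustering in $\mathbb{Z}^d$: points of the integer lattice $\mathbb{Z}^d$, with the $L_\infty$ distance, arrive one by one; upon arrival each point must be irrevocably assigned to a cluster (an existing one or a newly opened one), and every cluster must have $L_\infty$-diameter at most $1$. The cost is the number of clusters; serving a sequence optimally means using the offline minimum number of clusters. Online algorithm with advice (tape model): an oracle knowing the whole input writes an infinite binary advice tape, which the algorithm may read sequentially; the advice complexity is the number of bits read. *)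

theory Defs
  imports Complex_Main "HOL-Analysis.Finite_Cartesian_Product"
begin

definition linf_dist :: "int ^ 'd::finite \<Rightarrow> int ^ 'd \<Rightarrow> int" where
  "linf_dist x y = Max (range (\<lambda>i. \<bar>x $ i - y $ i\<bar>))"

text \<open>Only meaningful for finite nonempty sets; it is applied to nothing else.\<close>

definition linf_diameter :: "(int ^ 'd::finite) set \<Rightarrow> int" where
  "linf_diameter C = Max {linf_dist x y | x y. x \<in> C \<and> y \<in> C}"

text \<open>
  Clusters are named by natural numbers. A clustering of a request sequence is the list of the
  names assigned to the successive requests: a name that already occurred stands for an existing
  cluster, a fresh name for a newly opened one. Points may be requested repeatedly.
\<close>

definition cluster :: "(int ^ 'd::finite) list \<Rightarrow> nat list \<Rightarrow> nat \<Rightarrow> (int ^ 'd) set" where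
  "cluster xs cs c = {xs ! i | i. i < length xs \<and> cs ! i = c}"

definition valid_clustering :: "(int ^ 'd::finite) list \<Rightarrow> nat list \<Rightarrow> bool" where
  "valid_clustering xs cs \<longleftrightarrow>
     length cs = length xs \<and> (\<forall>c \<in> set cs. linf_diameter (cluster xs cs c) \<le> 1)"

definition cost :: "nat list \<Rightarrow> nat" where
  "cost cs = card (set cs)"

definition opt_cost :: "(int ^ 'd::finite) list \<Rightarrow> nat" where
  "opt_cost xs = (LEAST k. \<exists>cs. valid_clustering xs cs \<and> cost cs = k)"

definition optimal_clustering :: "(int ^ 'd::finite) list \<Rightarrow> nat list \<Rightarrow> bool" where
  "optimal_clustering xs cs \<longleftrightarrow> valid_clustering xs cs \<and> cost cs = opt_cost xs"

text \<open>
  A deterministic online algorithm with advice is represented by its decision function: given the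
  requests seen so far (the current one is the last) and the advice bits read so far, it either
  reads the next advice bit or assigns the current request to a cluster. No computability
  restriction is imposed.
\<close>

datatype action = Read | Assign nat

type_synonym 'd online_alg = "(int ^ 'd) list \<Rightarrow> bool list \<Rightarrow> action"

type_synonym tape = "nat \<Rightarrow> bool"

text \<open>
  \<open>serves A \<phi> xs p c q\<close>: after reading \<open>p\<close> bits of the tape \<open>\<phi>\<close>, the algorithm handles the last
  request of \<open>xs\<close> by assigning it to \<open>c\<close>, at which time \<open>q\<close> bits have been read in total. No \<open>c\<close>
  and \<open>q\<close> exist if the algorithm keeps reading forever.
\<close>

inductive serves ::
  "'d::finite online_alg \<Rightarrow> tape \<Rightarrow> (int ^ 'd) list \<Rightarrow> nat \<Rightarrow> nat \<Rightarrow> nat \<Rightarrow> bool"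
  for A :: "'d::finite online_alg" and \<phi> :: tape and xs :: "(int ^ 'd) list" where
  assign: "A xs (map \<phi> [0..<p]) = Assign c \<Longrightarrow> serves A \<phi> xs p c p"
| read: "A xs (map \<phi> [0..<p]) = Read \<Longrightarrow> serves A \<phi> xs (Suc p) c q \<Longrightarrow> serves A \<phi> xs p c q"

text \<open>
  \<open>run A \<phi> xs cs b\<close>: on the request sequence \<open>xs\<close> with advice tape \<open>\<phi>\<close>, the algorithm produces
  the clustering \<open>cs\<close> and reads exactly \<open>b\<close> bits of advice.
\<close>

inductive run ::
  "'d::finite online_alg \<Rightarrow> tape \<Rightarrow> (int ^ 'd) list \<Rightarrow> nat list \<Rightarrow> nat \<Rightarrow> bool"
  for A :: "'d::finite online_alg" and \<phi> :: tape where
  start: "run A \<phi> [] [] 0"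
| request: "run A \<phi> xs cs p \<Longrightarrow> serves A \<phi> (xs @ [x]) p c q \<Longrightarrow> run A \<phi> (xs @ [x]) (cs @ [c]) q"

end

theory Submission imports Defs begin

text \<open>
  A gadget consists of a centre \<open>c\<close> and its neighbours \<open>c \<plusminus> e\<^sub>i\<close>, followed by the points
  \<open>c - 2 s\<^sub>i e\<^sub>i\<close> for a sign vector \<open>s\<close>. The \<open>d + 1\<close> points \<open>c\<close> and \<open>c - 2 s\<^sub>i e\<^sub>i\<close> are pairwise
  at distance at least 2, and \<open>d + 1\<close> clusters suffice, so in an optimal clustering every cluster
  contains one of them. The only one close to \<open>c + s\<^sub>i e\<^sub>i\<close> is \<open>c\<close>, hence \<open>c\<close> shares its
  cluster with \<open>c + e\<^sub>i\<close> if and only if \<open>s\<^sub>i = 1\<close>. Take \<open>k\<close> gadgets far apart and postpone all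
  points depending on signs to the end: the clustering of the common prefix then encodes \<open>k d\<close>
  signs, and the request sequence has length \<open>k (1 + 3 d)\<close>. With fewer than \<open>k d\<close> bits read, two
  sign patterns would yield the same clustering of the prefix.
\<close>

section \<open>Runs of an online algorithm\<close>

lemma serves_mono: "serves A \<phi> xs p c q \<Longrightarrow> p \<le> q"
  by (induction rule: serves.induct) auto

text \<open>The algorithm sees a tape only through the bits read so far. Only the first computation
  is bounded by \<open>N\<close>; as long as the bits agree, the second takes the same actions and
  inherits the bound.\<close>

lemma serves_cong_tape:
  assumes "serves A \<phi> xs p c q" "serves A \<psi> xs p c' q'" "q \<le> N" "\<And>i. i < N \<Longrightarrow> \<phi> i = \<psi> i"
  shows "c = c' \<and> q = q'"
  using assms
proof (induction rule: serves.induct)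
  case (assign p c)
  then have "map \<phi> [0..<p] = map \<psi> [0..<p]" by simp
  with assign show ?case by (auto elim: serves.cases)
next
  case (read p c q)
  have "p \<le> N" using serves_mono[OF read.hyps(2)] read.prems(2) by simp
  then have "map \<phi> [0..<p] = map \<psi> [0..<p]" using read.prems(3) by simp
  with read.hyps(1) read.prems(1) have "serves A \<psi> xs (Suc p) c' q'"
    by (auto elim: serves.cases)
  with read show ?case by blast
qed

lemma run_length: "run A \<phi> xs cs b \<Longrightarrow> length cs = length xs"
  by (induction rule: run.induct) auto

lemma run_snocE:
  assumes "run A \<phi> (xs @ [x]) cs b"
  obtains cs' c p where "cs = cs' @ [c]" "run A \<phi> xs cs' p" "serves A \<phi> (xs @ [x]) p c b"
  using assms by (auto elim: run.cases)

text \<open>This is where the algorithm being online enters: future requests \<open>ys\<close> can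
  influence the clusters chosen for \<open>xs\<close> only through the tape.\<close>

lemma run_appendE:
  assumes "run A \<phi> (xs @ ys) cs b"
  obtains cs1 cs2 p where "cs = cs1 @ cs2" "run A \<phi> xs cs1 p" "p \<le> b"
  using assms
proof (induction ys arbitrary: cs b thesis rule: rev_induct)
  case Nil
  then show ?case using Nil.prems(1)[of cs "[]" b] by simp
next
  case (snoc y ys)
  from snoc.prems(2) obtain cs' c p where *: "cs = cs' @ [c]" "run A \<phi> (xs @ ys) cs' p"
    "serves A \<phi> ((xs @ ys) @ [y]) p c b"
    by (metis append.assoc run_snocE)
  obtain cs1 cs2 p' where "cs' = cs1 @ cs2" "run A \<phi> xs cs1 p'" "p' \<le> p"
    using snoc.IH *(2) by blast
  with *(1) serves_mono[OF *(3)] show ?case by (intro snoc.prems(1)[of cs1 "cs2 @ [c]" p']) auto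
qed

lemma run_cong_tape:
  assumes "run A \<phi> xs cs b" "run A \<psi> xs cs' b'" "b \<le> N" "\<And>i. i < N \<Longrightarrow> \<phi> i = \<psi> i"
  shows "cs = cs' \<and> b = b'"
  using assms
proof (induction xs arbitrary: cs b cs' b' rule: rev_induct)
  case Nil
  then show ?case by (auto elim: run.cases)
next
  case (snoc x xs)
  obtain ds c p where 1: "cs = ds @ [c]" "run A \<phi> xs ds p" "serves A \<phi> (xs @ [x]) p c b"
    using snoc.prems(1) by (rule run_snocE)
  obtain ds' c' p' where 2: "cs' = ds' @ [c']" "run A \<psi> xs ds' p'" "serves A \<psi> (xs @ [x]) p' c' b'"
    using snoc.prems(2) by (rule run_snocE)
  have "p \<le> N" using serves_mono[OF 1(3)] snoc.prems(3) by simp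
  then have "ds = ds' \<and> p = p'" using snoc.IH 1(2) 2(2) snoc.prems(4) by blast
  with 1 2 serves_cong_tape[of A \<phi> "xs @ [x]" p c b \<psi> c' b' N] snoc.prems(3,4) show ?case by auto
qed

section \<open>Valid and optimal clusterings\<close>

lemma linf_dist_le_iff: "linf_dist x y \<le> r \<longleftrightarrow> (\<forall>i. \<bar>x $ i - y $ i\<bar> \<le> r)"
  unfolding linf_dist_def by (subst Max_le_iff) auto

lemma linf_diameter_le_iff:
  assumes "finite C" "C \<noteq> {}"
  shows "linf_diameter C \<le> r \<longleftrightarrow> (\<forall>x\<in>C. \<forall>y\<in>C. linf_dist x y \<le> r)"
proof -
  have "{linf_dist x y | x y. x \<in> C \<and> y \<in> C} = (\<lambda>(x, y). linf_dist x y) ` (C \<times> C)" by auto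
  then show ?thesis unfolding linf_diameter_def using assms by (subst Max_le_iff) auto
qed

text \<open>Clusters of names in \<open>set cs\<close> are finite and nonempty, so the maximum in
  the diameter is meaningful and bounding it is a condition on pairs of positions.\<close>

lemma valid_clustering_iff:
  "valid_clustering xs cs \<longleftrightarrow> length cs = length xs \<and>
     (\<forall>i<length xs. \<forall>j<length xs. cs ! i = cs ! j \<longrightarrow> linf_dist (xs ! i) (xs ! j) \<le> 1)"
proof (cases "length cs = length xs")
  case True
  have "finite (cluster xs cs c)" for c by (auto simp: cluster_def)
  moreover have "cluster xs cs c \<noteq> {}" if "c \<in> set cs" for c
    using that True by (auto simp: cluster_def in_set_conv_nth)
  ultimately have "(\<forall>c\<in>set cs. linf_diameter (cluster xs cs c) \<le> 1) \<longleftrightarrow>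
      (\<forall>c\<in>set cs. \<forall>x\<in>cluster xs cs c. \<forall>y\<in>cluster xs cs c. linf_dist x y \<le> 1)"
    by (intro ball_cong refl linf_diameter_le_iff)
  also have "\<dots> \<longleftrightarrow>
      (\<forall>i<length xs. \<forall>j<length xs. cs ! i = cs ! j \<longrightarrow> linf_dist (xs ! i) (xs ! j) \<le> 1)"
  proof (intro iffI allI impI ballI)
    fix i j
    assume "\<forall>c\<in>set cs. \<forall>x\<in>cluster xs cs c. \<forall>y\<in>cluster xs cs c. linf_dist x y \<le> 1"
      and "i < length xs" "j < length xs" "cs ! i = cs ! j"
    moreover from this have "cs ! i \<in> set cs" "xs ! i \<in> cluster xs cs (cs ! i)"
      "xs ! j \<in> cluster xs cs (cs ! i)"
      using True by (auto simp: cluster_def)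
    ultimately show "linf_dist (xs ! i) (xs ! j) \<le> 1" by blast
  qed (auto simp: cluster_def)
  finally show ?thesis using True by (simp add: valid_clustering_def)
qed (simp add: valid_clustering_def)

text \<open>The sets \<open>B j\<close> may overlap: each request picks one index \<open>h x\<close>
  whose set contains it, and an injection into the naturals turns the indices into cluster
  names.\<close>

lemma opt_cost_le_card_cover:
  assumes "finite S" "set xs \<subseteq> (\<Union>j\<in>S. B j)"
    and diam: "\<And>j x y. j \<in> S \<Longrightarrow> x \<in> B j \<Longrightarrow> y \<in> B j \<Longrightarrow> linf_dist x y \<le> 1"
  shows "opt_cost xs \<le> card S"
proof -
  obtain h where h: "\<And>x. x \<in> set xs \<Longrightarrow> h x \<in> S \<and> x \<in> B (h x)"
    using assms(2) by (metis UN_E subset_eq)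
  obtain f :: "_ \<Rightarrow> nat" where f: "inj_on f S"
    using finite_imp_inj_to_nat_seg[OF assms(1)] by blast
  let ?cs = "map (f \<circ> h) xs"
  have "valid_clustering xs ?cs"
    unfolding valid_clustering_iff
  proof (intro conjI allI impI)
    fix i j assume ij: "i < length xs" "j < length xs" "?cs ! i = ?cs ! j"
    then have "h (xs ! i) = h (xs ! j)" using h by (auto dest!: inj_onD[OF f])
    then show "linf_dist (xs ! i) (xs ! j) \<le> 1"
      using diam[of "h (xs ! j)"] h[of "xs ! i"] h[of "xs ! j"] ij by simp
  qed simp
  then have "opt_cost xs \<le> cost ?cs" unfolding opt_cost_def by (intro Least_le) blast
  also have "\<dots> \<le> card (f ` S)" unfolding cost_def
    using h assms(1) by (intro card_mono) auto
  also have "\<dots> \<le> card S" using assms(1) by (rule card_image_le)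
  finally show ?thesis .
qed

text \<open>Pairwise distant anchors lie in \<open>card S\<close> different clusters, and the cost
  bound leaves no further cluster. So each request shares its cluster with some anchor close to it,
  which for positions \<open>p\<close> and \<open>q\<close> can only be the one indexed by
  \<open>j0\<close>.\<close>

lemma same_cluster_if_unique_anchor:
  assumes valid: "valid_clustering xs cs" and cost: "cost cs \<le> card S" and "finite S"
    and anchors: "a ` S \<subseteq> set xs"
    and sep: "\<And>i j. i \<in> S \<Longrightarrow> j \<in> S \<Longrightarrow> linf_dist (a i) (a j) \<le> 1 \<Longrightarrow> i = j"
    and p: "p < length xs" "\<And>j. j \<in> S \<Longrightarrow> linf_dist (xs ! p) (a j) \<le> 1 \<Longrightarrow> j = j0"
    and q: "q < length xs" "\<And>j. j \<in> S \<Longrightarrow> linf_dist (xs ! q) (a j) \<le> 1 \<Longrightarrow> j = j0"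
  shows "cs ! p = cs ! q"
proof -
  have close: "linf_dist (xs ! i) (xs ! j) \<le> 1"
    if "i < length xs" "j < length xs" "cs ! i = cs ! j" for i j
    using valid that by (simp add: valid_clustering_iff)
  have len: "length cs = length xs" using valid by (simp add: valid_clustering_iff)
  obtain pos where pos: "\<And>j. j \<in> S \<Longrightarrow> pos j < length xs \<and> xs ! pos j = a j"
  proof -
    have "\<forall>j\<in>S. \<exists>p. p < length xs \<and> xs ! p = a j"
      using anchors by (auto simp: in_set_conv_nth)
    from bchoice[OF this] show thesis using that by blast
  qed
  let ?f = "\<lambda>j. cs ! pos j"
  have "inj_on ?f S"
  proof (rule inj_onI)
    fix i j assume ij: "i \<in> S" "j \<in> S" "?f i = ?f j"
    then have "linf_dist (a i) (a j) \<le> 1" using close[of "pos i" "pos j"] pos by auto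
    then show "i = j" by (rule sep[OF ij(1,2)])
  qed
  then have "card (?f ` S) = card S" by (rule card_image)
  moreover have "?f ` S \<subseteq> set cs" using pos len by auto
  ultimately have "?f ` S = set cs"
    using cost by (intro card_seteq) (auto simp: cost_def)
  have "cs ! r = ?f j0"
    if r: "r < length xs" "\<And>j. j \<in> S \<Longrightarrow> linf_dist (xs ! r) (a j) \<le> 1 \<Longrightarrow> j = j0" for r
  proof -
    have "cs ! r \<in> ?f ` S" using \<open>?f ` S = set cs\<close> r(1) len by simp
    then obtain j where j: "j \<in> S" "cs ! r = ?f j" by blast
    then have "linf_dist (xs ! r) (a j) \<le> 1" using close[of r "pos j"] r(1) pos[of j] by auto
    then show ?thesis using r(2) j by blast
  qed
  then show ?thesis using p q by simp
qed

section \<open>The gadgets\<close>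

text \<open>Gadgets are placed 10 apart along the diagonal; any spacing of at least 6 would do.\<close>

definition centre :: "nat \<Rightarrow> int ^ 'd::finite" where
  "centre t = (\<chi> j. 10 * int t)"

definition arm :: "nat \<Rightarrow> 'd \<Rightarrow> int \<Rightarrow> int ^ 'd::finite" where
  "arm t i e = (\<chi> j. 10 * int t + (if j = i then e else 0))"

text \<open>A sign pattern is encoded by the set of its positive entries, so the patterns for
  \<open>k\<close> gadgets form a power set.\<close>

definition sign :: "'b set \<Rightarrow> 'b \<Rightarrow> int" where
  "sign S z = (if z \<in> S then 1 else -1)"

lemma abs_sign [simp]: "\<bar>sign S z\<bar> = 1"
  by (simp add: sign_def)

text \<open>Points of different gadgets differ by at least 10 - 4 = 6 in every coordinate. Within a
  gadget, arms in different directions are compared with 0 in coordinates \<open>i\<close> and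
  \<open>i'\<close> separately.\<close>

lemma linf_dist_arm_arm:
  assumes "\<bar>e\<bar> \<le> 2" "\<bar>e'\<bar> \<le> 2"
  shows "linf_dist (arm t i e) (arm t' i' e') \<le> 1 \<longleftrightarrow>
    t = t' \<and> (if i = i' then \<bar>e - e'\<bar> \<le> 1 else \<bar>e\<bar> \<le> 1 \<and> \<bar>e'\<bar> \<le> 1)" (is "?L \<longleftrightarrow> ?R")
proof
  assume ?L
  then have *: "\<bar>arm t i e $ j - arm t' i' e' $ j\<bar> \<le> 1" for j by (simp add: linf_dist_le_iff)
  have "t = t'" using *[of i] assms by (auto simp: arm_def split: if_splits)
  then show ?R using *[of i] *[of i'] by (auto simp: arm_def split: if_splits)
qed (auto simp: linf_dist_le_iff arm_def)

lemma centre_eq_arm: "centre t = arm t i 0"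
  by (simp add: centre_def arm_def)

lemma linf_dist_arm_centre:
  "\<bar>e\<bar> \<le> 2 \<Longrightarrow> linf_dist (arm t i e) (centre t') \<le> 1 \<longleftrightarrow> t = t' \<and> \<bar>e\<bar> \<le> 1"
  using linf_dist_arm_arm[of e 0 t i t' i] by (simp add: centre_eq_arm[of _ i])

lemma linf_dist_centre_arm:
  "\<bar>e\<bar> \<le> 2 \<Longrightarrow> linf_dist (centre t') (arm t i e) \<le> 1 \<longleftrightarrow> t = t' \<and> \<bar>e\<bar> \<le> 1"
  using linf_dist_arm_arm[of 0 e t' i t i] by (auto simp: centre_eq_arm[of _ i])

lemma linf_dist_centre_centre: "linf_dist (centre t) (centre t') \<le> 1 \<longleftrightarrow> t = t'"
  by (auto simp: linf_dist_le_iff centre_def)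

fun anchor :: "(nat \<times> 'd) set \<Rightarrow> nat \<times> 'd option \<Rightarrow> int ^ 'd::finite" where
  "anchor S (t, None) = centre t"
| "anchor S (t, Some i) = arm t i (- 2 * sign S (t, i))"

text \<open>These are the intended optimal clusters, one around each anchor: the neighbours on the
  signed side join the centre, each opposite neighbour joins the far point beyond it.\<close>

fun block :: "(nat \<times> 'd) set \<Rightarrow> nat \<times> 'd option \<Rightarrow> (int ^ 'd::finite) set" where
  "block S (t, None) = insert (centre t) (range (\<lambda>i. arm t i (sign S (t, i))))"
| "block S (t, Some i) = {arm t i (- sign S (t, i)), arm t i (- 2 * sign S (t, i))}"

lemma anchor_separated:
  "linf_dist (anchor S j) (anchor S j') \<le> 1 \<Longrightarrow> j = j'"
  by (cases "(S, j)" rule: anchor.cases; cases "(S, j')" rule: anchor.cases)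
    (auto simp: linf_dist_arm_arm linf_dist_arm_centre linf_dist_centre_arm linf_dist_centre_centre
      abs_mult split: if_splits)

text \<open>The far point in direction \<open>i\<close> is at distance 3, those in the other
  directions at distance 2, and other gadgets are farther still.\<close>

lemma anchor_near_arm:
  assumes "linf_dist (arm t i (sign S (t, i))) (anchor S j) \<le> 1"
  shows "j = (t, None)"
  using assms by (cases "(S, j)" rule: anchor.cases)
    (auto simp: linf_dist_arm_arm linf_dist_arm_centre abs_mult sign_def split: if_splits)

lemma linf_dist_block_le:
  "x \<in> block S j \<Longrightarrow> y \<in> block S j \<Longrightarrow> linf_dist x y \<le> 1"
  by (cases "(S, j)" rule: block.cases)
    (auto simp: linf_dist_arm_arm linf_dist_arm_centre linf_dist_centre_arm linf_dist_centre_centre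
      abs_mult sign_def)

section \<open>Request sequences and their optimal clusterings\<close>

definition prefix_requests :: "'d list \<Rightarrow> nat \<Rightarrow> (int ^ 'd::finite) list" where
  "prefix_requests us k = map centre [0..<k]
     @ map (\<lambda>(t, i). arm t i 1) (List.product [0..<k] us)
     @ map (\<lambda>(t, i). arm t i (- 1)) (List.product [0..<k] us)"

definition suffix_requests ::
  "'d list \<Rightarrow> nat \<Rightarrow> (nat \<times> 'd) set \<Rightarrow> (int ^ 'd::finite) list" where
  "suffix_requests us k S = map (\<lambda>(t, i). arm t i (- 2 * sign S (t, i))) (List.product [0..<k] us)"

lemma length_requests:
  "length (prefix_requests us k @ suffix_requests us k S) = k * (1 + 3 * length us)"
  by (simp add: prefix_requests_def suffix_requests_def)

lemma opt_cost_requests: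
  fixes us :: "'d::finite list"
  shows "opt_cost (prefix_requests us k @ suffix_requests us k S)
    \<le> card ({..<k} \<times> (UNIV :: 'd option set))"
proof (rule opt_cost_le_card_cover[where B = "block S"])
  have "\<exists>j\<in>{..<k} \<times> UNIV. x \<in> block S j"
    if x: "x \<in> set (prefix_requests us k @ suffix_requests us k S)" for x
  proof -
    \<comment> \<open>The offset \<open>sign S (t, i)\<close> falls into the block of the centre,
      the other two into the block of the far point.\<close>
    have "arm t i e \<in> block S (t, None) \<or> arm t i e \<in> block S (t, Some i)"
      if "e = 1 \<or> e = -1 \<or> e = - 2 * sign S (t, i)" for t i e
      using that by (auto simp: sign_def)
    moreover have "centre t \<in> block S (t, None)" for t by simp
    ultimately show ?thesis
      using x unfolding prefix_requests_def suffix_requests_def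
      by (auto simp del: block.simps) (blast intro: SigmaI lessThan_iff[THEN iffD2])+
  qed
  then show "set (prefix_requests us k @ suffix_requests us k S)
      \<subseteq> (\<Union>j\<in>{..<k} \<times> UNIV. block S j)" by blast
qed (auto simp: linf_dist_block_le simp del: block.simps)

lemma prefix_clustering_encodes_sign:
  fixes us :: "'d::finite list"
  assumes us: "set us = UNIV"
    and opt: "optimal_clustering (prefix_requests us k @ suffix_requests us k S) cs"
    and t: "t < k"
    and p: "p < length (prefix_requests us k)" "prefix_requests us k ! p = centre t"
    and q: "q < length (prefix_requests us k)" "prefix_requests us k ! q = arm t i 1"
  shows "(t, i) \<in> S \<longleftrightarrow> cs ! q = cs ! p"
proof -
  let ?P = "prefix_requests us k"
  let ?xs = "?P @ suffix_requests us k S"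
  let ?J = "{..<k} \<times> (UNIV :: 'd option set)"
  have valid: "valid_clustering ?xs cs" and cost: "cost cs \<le> card ?J"
    using opt opt_cost_requests[of us k S] by (auto simp: optimal_clustering_def)
  have anchors: "anchor S ` ?J \<subseteq> set ?xs"
  proof
    fix x assume "x \<in> anchor S ` ?J"
    then obtain t o' where "t < k" "x = anchor S (t, o')" by auto
    then show "x \<in> set ?xs"
      using us by (cases o') (auto simp: prefix_requests_def suffix_requests_def image_iff)
  qed
  have same: "cs ! r = cs ! p"
    if r: "r < length ?P" "?P ! r = arm t i (sign S (t, i))" for r
  proof (rule same_cluster_if_unique_anchor[OF valid cost _ anchors])
    show "j = (t, None)" if "linf_dist (?xs ! r) (anchor S j) \<le> 1" for j
      using that r anchor_near_arm[of t i S j] by (simp add: nth_append)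
    show "j = (t, None)" if "linf_dist (?xs ! p) (anchor S j) \<le> 1" for j
      using that p anchor_separated[of S "(t, None)" j] by (simp add: nth_append)
    show "j = j'" if "linf_dist (anchor S j) (anchor S j') \<le> 1" for j j'
      using that by (rule anchor_separated)
  qed (use p r in auto)
  show ?thesis
  proof (cases "(t, i) \<in> S")
    case True
    then show ?thesis using same[of q] q by (simp add: sign_def)
  next
    case False
    \<comment> \<open>For a negative sign it is the opposite neighbour that must join the centre. It
      is at distance 2 from \<open>arm t i 1\<close>, which is thereby excluded from that
      cluster.\<close>
    have "arm t i (- 1) \<in> set ?P" using t us by (auto simp: prefix_requests_def image_iff)
    then obtain r where r: "r < length ?P" "?P ! r = arm t i (- 1)" by (metis in_set_conv_nth)
    have "cs ! r = cs ! p" using same[of r] r False by (simp add: sign_def)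
    moreover have "\<not> linf_dist (?xs ! q) (?xs ! r) \<le> 1"
      using q r by (simp add: nth_append linf_dist_arm_arm)
    ultimately show ?thesis
      using valid q r False by (auto simp: valid_clustering_iff)
  qed
qed

section \<open>Counting advice strings against sign patterns\<close>

lemma advice_lower_bound:
  fixes A :: "'d::finite online_alg" and advice :: "(int ^ 'd) list \<Rightarrow> tape"
  assumes "k > 0"
  shows "\<exists>\<sigma>. length \<sigma> = k * (1 + 3 * CARD('d)) \<and>
    (\<forall>cs b. run A (advice \<sigma>) \<sigma> cs b \<and> optimal_clustering \<sigma> cs \<longrightarrow> b \<ge> k * CARD('d))"
proof (rule ccontr)
  assume neg: "\<not> ?thesis"
  obtain us :: "'d list" where us: "set us = UNIV" "length us = CARD('d)"
    by (metis distinct_card finite_distinct_list finite_class.finite_UNIV)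
  define P where "P = prefix_requests us k"
  define Q where "Q S = suffix_requests us k S" for S
  \<comment> \<open>The largest number of bits below the claimed bound; \<open>k > 0\<close> keeps
    the subtraction from being truncated.\<close>
  define N where "N = k * CARD('d) - 1"
  have kd: "k * CARD('d) > 0" using assms by simp
  have "\<exists>cs b. run A (advice (P @ Q S)) (P @ Q S) cs b \<and> optimal_clustering (P @ Q S) cs \<and> b \<le> N"
    for S
  proof -
    have "length (P @ Q S) = k * (1 + 3 * CARD('d))"
      using length_requests[of us k S] us(2) by (simp only: P_def Q_def)
    then obtain cs b where "run A (advice (P @ Q S)) (P @ Q S) cs b"
      "optimal_clustering (P @ Q S) cs" "\<not> k * CARD('d) \<le> b"
      using neg by blast
    moreover from this(3) have "b \<le> N" using kd by (simp add: N_def)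
    ultimately show ?thesis by blast
  qed
  then obtain cs b where cs: "run A (advice (P @ Q S)) (P @ Q S) (cs S) (b S)"
    "optimal_clustering (P @ Q S) (cs S)" "b S \<le> N" for S
    by metis
  have run_prefix: "\<exists>p \<le> N. run A (advice (P @ Q S)) P (take (length P) (cs S)) p" for S
  proof -
    obtain cs1 cs2 p where "cs S = cs1 @ cs2" "run A (advice (P @ Q S)) P cs1 p" "p \<le> b S"
      using cs(1)[of S] by (rule run_appendE)
    with run_length[of A _ P cs1 p] cs(3)[of S] show ?thesis by (intro exI[of _ p]) simp
  qed
  let ?X = "{..<k} \<times> (UNIV :: 'd set)"
  \<comment> \<open>The oracle knows \<open>S\<close>, but only the first \<open>N\<close> bits of
    its tape can be read. There are 2^N such strings and 2^(k d) patterns, hence a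
    collision.\<close>
  define f where "f S = map (advice (P @ Q S)) [0..<N]" for S
  have "\<not> inj_on f (Pow ?X)"
  proof
    assume "inj_on f (Pow ?X)"
    moreover have "f ` Pow ?X \<subseteq> {bs. set bs \<subseteq> UNIV \<and> length bs = N}" by (auto simp: f_def)
    ultimately have "card (Pow ?X) \<le> card {bs :: bool list. set bs \<subseteq> UNIV \<and> length bs = N}"
      by (intro card_inj_on_le finite_lists_length_eq) simp_all
    also have "\<dots> = 2 ^ N" by (subst card_lists_length_eq) auto
    also have "\<dots> < 2 ^ (k * CARD('d))" using kd by (simp add: N_def)
    also have "\<dots> = card (Pow ?X)" by (simp add: card_Pow card_cartesian_product)
    finally show False by simp
  qed
  then obtain S T where ST: "S \<subseteq> ?X" "T \<subseteq> ?X" "S \<noteq> T" "f S = f T" by (auto simp: inj_on_def)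
  have agree: "advice (P @ Q S) i = advice (P @ Q T) i" if "i < N" for i
    using ST(4) that by (auto simp: f_def)
  \<comment> \<open>The two full inputs differ only after \<open>P\<close>, and the tapes agree on
    all bits read while serving \<open>P\<close>.\<close>
  have same: "take (length P) (cs S) = take (length P) (cs T)"
  proof -
    obtain p p' where "p \<le> N" "run A (advice (P @ Q S)) P (take (length P) (cs S)) p"
      "run A (advice (P @ Q T)) P (take (length P) (cs T)) p'"
      using run_prefix[of S] run_prefix[of T] by blast
    with run_cong_tape[of A "advice (P @ Q S)" P _ p "advice (P @ Q T)"] agree
    show ?thesis by blast
  qed
  have "(t, i) \<in> S \<longleftrightarrow> (t, i) \<in> T" if t: "t < k" for t i
  proof -
    have "centre t \<in> set P" "arm t i 1 \<in> set P"
      using t us(1) by (auto simp: P_def prefix_requests_def image_iff)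
    then obtain p q where pq: "p < length P" "P ! p = centre t" "q < length P" "P ! q = arm t i 1"
      by (metis in_set_conv_nth)
    have "(t, i) \<in> U \<longleftrightarrow> take (length P) (cs U) ! q = take (length P) (cs U) ! p" for U
      using prefix_clustering_encodes_sign[OF us(1) cs(2)[of U, unfolded P_def Q_def] t] pq
      by (simp add: P_def)
    then show ?thesis using same by simp
  qed
  then have "S = T" using ST(1,2) by auto
  with ST(3) show False ..
qed

theorem theorem2:
  fixes n :: nat
  shows
    "\<not> (\<exists>(A :: 'd::finite online_alg) (oracle :: (int ^ 'd) list \<Rightarrow> tape).
          \<forall>\<sigma>. length \<sigma> \<ge> n \<longrightarrow>
            (\<exists>cs b. run A (oracle \<sigma>) \<sigma> cs b \<and> optimal_clustering \<sigma> cs \<and>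
                    real b < real CARD('d) / (1 + 3 * real CARD('d)) * real (length \<sigma>)))
     \<and> (\<forall>(A :: 'd online_alg) (oracle :: (int ^ 'd) list \<Rightarrow> tape).
          (\<forall>\<sigma>. \<exists>cs b. run A (oracle \<sigma>) \<sigma> cs b \<and> optimal_clustering \<sigma> cs) \<longrightarrow>
          (\<exists>m \<ge> n. \<exists>\<sigma> cs b. length \<sigma> = m \<and> run A (oracle \<sigma>) \<sigma> cs b \<and>
                    real b \<ge> real CARD('d) / (1 + 3 * real CARD('d)) * real m))"
proof -
  \<comment> \<open>Taking \<open>Suc n\<close> gadgets makes their number positive and the sequence
    at least \<open>n\<close> long.\<close>
  let ?d = "CARD('d)" and ?k = "Suc n"
  let ?m = "?k * (1 + 3 * ?d)"
  have m: "n \<le> ?m" by simp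
  \<comment> \<open>The factor 1 + 3 d cancels, which reduces the real inequality to one between
    naturals.\<close>
  have bound: "real b < real CARD('d) / (1 + 3 * real CARD('d)) * real ?m \<longleftrightarrow> b < ?k * ?d" for b
  proof -
    have "real CARD('d) / (1 + 3 * real CARD('d)) * real ?m = real (?k * ?d)"
      by (simp add: field_simps add_pos_nonneg)
    then show ?thesis by (simp only: of_nat_less_iff)
  qed
  have hard: "\<exists>\<sigma>. length \<sigma> = ?m \<and>
      (\<forall>cs b. run A (advice \<sigma>) \<sigma> cs b \<and> optimal_clustering \<sigma> cs \<longrightarrow> b \<ge> ?k * ?d)"
    for A :: "'d online_alg" and advice :: "(int ^ 'd) list \<Rightarrow> tape"
    using advice_lower_bound[of ?k A advice] by simp
  show ?thesis
  proof (intro conjI notI allI impI)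
    assume "\<exists>(A :: 'd online_alg) (advice :: (int ^ 'd) list \<Rightarrow> tape). \<forall>\<sigma>. length \<sigma> \<ge> n \<longrightarrow>
      (\<exists>cs b. run A (advice \<sigma>) \<sigma> cs b \<and> optimal_clustering \<sigma> cs \<and>
        real b < real CARD('d) / (1 + 3 * real CARD('d)) * real (length \<sigma>))"
    then obtain A :: "'d online_alg" and advice :: "(int ^ 'd) list \<Rightarrow> tape" where
      alg: "\<And>\<sigma>. length \<sigma> \<ge> n \<Longrightarrow> \<exists>cs b. run A (advice \<sigma>) \<sigma> cs b \<and> optimal_clustering \<sigma> cs \<and>
        real b < real CARD('d) / (1 + 3 * real CARD('d)) * real (length \<sigma>)"
      by blast
    obtain \<sigma> where \<sigma>: "length \<sigma> = ?m"
      "\<And>cs b. run A (advice \<sigma>) \<sigma> cs b \<and> optimal_clustering \<sigma> cs \<longrightarrow> b \<ge> ?k * ?d"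
      using hard[of A advice] by blast
    show False using alg[of \<sigma>] \<sigma>(2) m unfolding \<sigma>(1) bound by (meson not_less)
  next
    fix A :: "'d online_alg" and advice :: "(int ^ 'd) list \<Rightarrow> tape"
    assume alg: "\<forall>\<sigma>. \<exists>cs b. run A (advice \<sigma>) \<sigma> cs b \<and> optimal_clustering \<sigma> cs"
    obtain \<sigma> where \<sigma>: "length \<sigma> = ?m"
      "\<And>cs b. run A (advice \<sigma>) \<sigma> cs b \<and> optimal_clustering \<sigma> cs \<longrightarrow> b \<ge> ?k * ?d"
      using hard[of A advice] by blast
    obtain cs b where cs: "run A (advice \<sigma>) \<sigma> cs b" "optimal_clustering \<sigma> cs" using alg by blast
    have "real b \<ge> real CARD('d) / (1 + 3 * real CARD('d)) * real ?m"
      using \<sigma>(2) cs bound[of b] by (meson not_less)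
    then show "\<exists>m \<ge> n. \<exists>\<sigma> cs b. length \<sigma> = m \<and> run A (advice \<sigma>) \<sigma> cs b \<and>
        real b \<ge> real CARD('d) / (1 + 3 * real CARD('d)) * real m"
      using m \<sigma>(1) cs(1) by blast
  qed
qed

end
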